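(* If $W_1$ and $W_2$ are monotone kernels on an ordered probability space $(S,\mu,\prec)$, then $$\|W_1-W_2\|_{L^1(S^2)}\le 10\,\|W_1-W_2\|_\square^{2/3}.$$
   Context: An ordered probability space $(S,\mu,\prec)$ is a probability space $(S,\mathcal F,\mu)$ together with a (strict) linear order $\prec$ on $S$ that is measurable, i.e., $\{(x,y):x\prec y\}$ is a measurable subset of $S\times S$ (with the product $\sigma$-field). A kernel on $S$ is a symmetric measurable function $W:S^2\to[0,1]$. It is monotone on $(S,\prec)$ if $W(x_1,y_1)\le W(x_2,y_2)$ whenever $x_1\preceq x_2$ and $y_1\preceq y_2$. For $W\in L^1(S^2)$ the cut norm is $\|W\|_\square=\sup\bigl|\int_{S^2}W(x,y)f(x)g(y)\,d\mu(x)\,d\mu(y)\bigr|$, the supremum being over all measurable $f,g:S\to[-1,1]$. *)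

theory Defs
  imports "HOL-Probability.Probability"
begin

text \<open>
  The ground set \<open>S\<close> is \<open>space M\<close>. The condition \<open>measurable_order\<close> also forces
  \<open>r \<subseteq> space M \<times> space M\<close>, so that transitivity and irreflexivity of \<open>r\<close>
  speak about points of \<open>S\<close> only.
\<close>

locale ordered_prob_space = prob_space M for M :: "'a measure" +
  fixes r :: "'a rel"
  assumes strict_linear_order: "strict_linear_order_on (space M) r"
    and measurable_order: "r \<in> sets (M \<Otimes>\<^sub>M M)"

definition kernel_on :: "'a measure \<Rightarrow> ('a \<times> 'a \<Rightarrow> real) \<Rightarrow> bool" where
  "kernel_on M W \<longleftrightarrow>
     W \<in> borel_measurable (M \<Otimes>\<^sub>M M) \<and>
     (\<forall>x\<in>space M. \<forall>y\<in>space M. W (x, y) = W (y, x)) \<and>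
     (\<forall>x\<in>space M. \<forall>y\<in>space M. W (x, y) \<in> {0..1})"

definition monotone_kernel :: "'a measure \<Rightarrow> 'a rel \<Rightarrow> ('a \<times> 'a \<Rightarrow> real) \<Rightarrow> bool" where
  "monotone_kernel M r W \<longleftrightarrow>
     kernel_on M W \<and>
     (\<forall>x1\<in>space M. \<forall>x2\<in>space M. \<forall>y1\<in>space M. \<forall>y2\<in>space M.
        (x1, x2) \<in> r\<^sup>= \<longrightarrow> (y1, y2) \<in> r\<^sup>= \<longrightarrow> W (x1, y1) \<le> W (x2, y2))"

definition L1_norm :: "'b measure \<Rightarrow> ('b \<Rightarrow> real) \<Rightarrow> real" where
  "L1_norm N U = (\<integral>z. \<bar>U z\<bar> \<partial>N)"

text \<open>
  Meaningful only for \<open>U\<close> integrable over \<open>M \<Otimes>\<^sub>M M\<close>; the set of values is then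
  bounded by the \<open>L\<^sup>1\<close> norm of \<open>U\<close>, so the supremum is a genuine one.
\<close>

definition cut_norm :: "'a measure \<Rightarrow> ('a \<times> 'a \<Rightarrow> real) \<Rightarrow> real" where
  "cut_norm M U =
     Sup {\<bar>\<integral>(x, y). U (x, y) * f x * g y \<partial>(M \<Otimes>\<^sub>M M)\<bar> | f g.
            f \<in> borel_measurable M \<and> f \<in> space M \<rightarrow> {-1..1} \<and>
            g \<in> borel_measurable M \<and> g \<in> space M \<rightarrow> {-1..1}}"

end

theory Submission
  imports Defs
begin

text \<open>
  Cut \<open>S\<close> into \<open>n\<close> consecutive intervals of measure \<open>1 / n\<close>. For a monotone kernel the
  supremum on the cell \<open>(i, j)\<close> is at most the infimum on the cell \<open>(i + 1, j + 1)\<close>, so the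
  oscillations telescope along the diagonals and sum to at most \<open>2 n\<close>. Hence replacing \<open>W\<^sub>1 - W\<^sub>2\<close>
  by its cell averages costs at most \<open>4 / n\<close> in \<open>L\<^sup>1\<close>. For the \<open>n \<times> n\<close> matrix of cell
  integrals, Khintchine's inequality bounds the sum of absolute values by \<open>2 \<surd>n\<close> times the cut
  norm \<open>\<delta>\<close>. Taking \<open>n \<approx> \<delta> powr (-2/3)\<close> balances the two errors. Atoms of \<open>\<mu>\<close> are split
  fractionally between consecutive intervals, so the intervals are really a partition of unity.
\<close>

subsection \<open>Random signs\<close>

text \<open>The expectation of \<open>F\<close> over \<open>n\<close> independent uniform signs,
  with all coordinates from \<open>n\<close> on set to 1. The recursion averages over one sign at a
  time, so moment computations reduce to two-point averages.\<close>

fun sign_avg :: "nat \<Rightarrow> ((nat \<Rightarrow> real) \<Rightarrow> real) \<Rightarrow> real" where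
  "sign_avg 0 F = F (\<lambda>_. 1)"
| "sign_avg (Suc n) F = sign_avg n (\<lambda>s. (F (s(n := 1)) + F (s(n := -1))) / 2)"

lemma sign_avg_add: "sign_avg n (\<lambda>s. F s + G s) = sign_avg n F + sign_avg n G"
proof (induction n arbitrary: F G)
  case (Suc n)
  have "(\<lambda>s. (F (s(n := 1)) + G (s(n := 1)) + (F (s(n := -1)) + G (s(n := -1)))) / 2) =
    (\<lambda>s. (F (s(n := 1)) + F (s(n := -1))) / 2 + (G (s(n := 1)) + G (s(n := -1))) / 2)"
    by (auto simp: field_simps)
  then show ?case by (simp add: Suc)
qed simp

lemma sign_avg_cmult: "sign_avg n (\<lambda>s. c * F s) = c * sign_avg n F"
proof (induction n arbitrary: F)
  case (Suc n)
  have "(\<lambda>s. (c * F (s(n := 1)) + c * F (s(n := -1))) / 2) =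
    (\<lambda>s. c * ((F (s(n := 1)) + F (s(n := -1))) / 2))"
    by (auto simp: field_simps)
  then show ?case by (simp add: Suc del: times_divide_eq_right)
qed simp

lemma sign_avg_const: "sign_avg n (\<lambda>_. c) = c"
  by (induction n) auto

lemma sign_avg_sum: "sign_avg n (\<lambda>s. \<Sum>i\<in>I. F i s) = (\<Sum>i\<in>I. sign_avg n (F i))"
  by (induction I rule: infinite_finite_induct) (auto simp: sign_avg_add sign_avg_const)

lemma sign_avg_mono:
  assumes "\<And>s. (\<And>j. s j \<in> {-1, 1}) \<Longrightarrow> F s \<le> G s"
  shows "sign_avg n F \<le> sign_avg n G"
  using assms
proof (induction n arbitrary: F G)
  case (Suc n)
  have step: "(F (s(n := 1)) + F (s(n := -1))) / 2 \<le> (G (s(n := 1)) + G (s(n := -1))) / 2"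
    if "\<And>j. s j \<in> {-1, 1}" for s
  proof -
    have "F (s(n := 1)) \<le> G (s(n := 1))" "F (s(n := -1)) \<le> G (s(n := -1))"
      using that by (intro Suc.prems; simp)+
    then show ?thesis by simp
  qed
  show ?case unfolding sign_avg.simps by (rule Suc.IH, rule step, blast)
qed simp

section \<open>Moments of random sign sums and Khintchine's inequality\<close>

lemma sign_avg_second_moment:
  "sign_avg n (\<lambda>s. (\<Sum>j<n. a j * s j)\<^sup>2) = (\<Sum>j<n. (a j)\<^sup>2)"
proof (induction n)
  case (Suc n)
  \<comment> \<open>With x the sum of the first \<open>n\<close> terms, averaging over the last sign
    cancels the cross term \<open>2 * x * a n\<close>.\<close>
  have *: "((x + a n)\<^sup>2 + (x - a n)\<^sup>2) / 2 = x\<^sup>2 + (a n)\<^sup>2" for x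
    by (simp add: power2_eq_square algebra_simps)
  show ?case by (simp add: * sign_avg_add sign_avg_const Suc)
qed simp

text \<open>Averaging over the last sign kills the odd powers of \<open>a n\<close>; the surviving
  mixed term is known from the second moment. The constant 3 is the Gaussian one and turns the
  binomial coefficient 6 into the cross term of a square.\<close>

lemma sign_avg_fourth_moment_le:
  "sign_avg n (\<lambda>s. (\<Sum>j<n. a j * s j) ^ 4) \<le> 3 * (\<Sum>j<n. (a j)\<^sup>2)\<^sup>2"
proof (induction n)
  case (Suc n)
  have *: "((x + a n) ^ 4 + (x - a n) ^ 4) / 2 = x ^ 4 + (6 * (a n)\<^sup>2 * x\<^sup>2 + a n ^ 4)" for x
    by (simp add: power2_eq_square power4_eq_xxxx algebra_simps)
  define v where "v = (\<Sum>j<n. (a j)\<^sup>2)"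
  have "sign_avg (Suc n) (\<lambda>s. (\<Sum>j<Suc n. a j * s j) ^ 4) =
    sign_avg n (\<lambda>s. (\<Sum>j<n. a j * s j) ^ 4) + 6 * (a n)\<^sup>2 * v + a n ^ 4"
    by (simp add: * sign_avg_add sign_avg_const sign_avg_cmult sign_avg_second_moment v_def)
  also have "\<dots> \<le> 3 * v\<^sup>2 + 6 * (a n)\<^sup>2 * v + a n ^ 4"
    using Suc by (simp add: v_def)
  also have "\<dots> \<le> 3 * (v + (a n)\<^sup>2)\<^sup>2"
  proof -
    have "3 * (v + (a n)\<^sup>2)\<^sup>2 = 3 * v\<^sup>2 + 6 * (a n)\<^sup>2 * v + a n ^ 4 + 2 * a n ^ 4"
      by (simp add: power2_eq_square power4_eq_xxxx algebra_simps)
    then show ?thesis by simp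
  qed
  finally show ?case by (simp add: v_def)
qed simp

text \<open>The tangent at \<open>29/50\<close>, close to the maximiser \<open>1 / \<surd>3\<close> of \<open>x - x\<^sup>3\<close>.\<close>

lemma abs_ge_quartic: "5 / 2 * (x\<^sup>2 - x ^ 4) \<le> \<bar>x :: real\<bar>"
proof -
  define y where "y = \<bar>x\<bar>"
  \<comment> \<open>For t = 29/50 this product is y^3 - 3 t^2 y + 2 t^3, the gap between y^3 and its
    tangent at t. Since 3 t^2 exceeds 1, it gives y - y^3 \<le> 2 t^3 for y \<ge> 0, and 2 t^3 <
    2/5.\<close>
  have "0 \<le> (y - 29/50)\<^sup>2 * (y + 29/25)"
    by (auto simp: y_def)
  also have "\<dots> = y ^ 3 - 2523/2500 * y + 24389/62500"
    by (simp add: power2_eq_square power3_eq_cube field_simps)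
  finally have "y - y ^ 3 \<le> 2 / 5"
    using abs_ge_zero[of x, folded y_def] by linarith
  then have "y * (y - y ^ 3) \<le> y * (2 / 5)"
    by (intro mult_left_mono) (auto simp: y_def)
  then have "y\<^sup>2 - y ^ 4 \<le> y * (2 / 5)"
    by (simp add: algebra_simps power2_eq_square power3_eq_cube power4_eq_xxxx)
  moreover have "y\<^sup>2 = x\<^sup>2" "y ^ 4 = x ^ 4"
    by (simp_all add: y_def)
  ultimately show ?thesis by (simp add: y_def)
qed

text \<open>The absolute value is bounded below by a quartic polynomial, whose average needs only
  the second moment and, the quartic coefficient being negative, an upper bound for the fourth. This
  yields the factor 5/9, just above the 1/2 required.\<close>

lemma khintchine_l2: "sqrt (\<Sum>j<n. (a j)\<^sup>2) \<le> 2 * sign_avg n (\<lambda>s. \<bar>\<Sum>j<n. a j * s j\<bar>)"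
proof -
  define v where "v = (\<Sum>j<n. (a j)\<^sup>2)"
  define A where "A = sign_avg n (\<lambda>s. \<bar>\<Sum>j<n. a j * s j\<bar>)"
  have "v \<ge> 0" by (simp add: v_def sum_nonneg)
  have A0: "A \<ge> 0"
    using sign_avg_mono[of "\<lambda>_. 0" "\<lambda>s. \<bar>\<Sum>j<n. a j * s j\<bar>" n] by (simp add: A_def sign_avg_const)
  show ?thesis
  proof (cases "v = 0")
    case True
    then show ?thesis using A0 by (simp add: v_def A_def)
  next
    case False
    with \<open>v \<ge> 0\<close> have "v > 0" by simp
    define \<sigma> where "\<sigma> = sqrt v"
    have \<sigma>: "\<sigma> > 0" "v = \<sigma>\<^sup>2" using \<open>v > 0\<close> by (simp_all add: \<sigma>_def)
    \<comment> \<open>\<open>abs_ge_quartic\<close> rescaled: at x / (c \<sigma>) the averaged lower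
      bound is 5/2 \<sigma> (1/c - 3/c^3), which is largest at c = 3.\<close>
    have *: "5 / (6 * \<sigma>) * x\<^sup>2 + (- 5 / (54 * \<sigma> ^ 3)) * x ^ 4 \<le> \<bar>x\<bar>" for x
    proof -
      have "3 * \<sigma> * (5 / 2 * ((x / (3 * \<sigma>))\<^sup>2 - (x / (3 * \<sigma>)) ^ 4)) \<le> 3 * \<sigma> * \<bar>x / (3 * \<sigma>)\<bar>"
        using \<sigma> by (intro mult_left_mono abs_ge_quartic) auto
      also have "\<dots> = \<bar>x\<bar>" using \<sigma> by (simp add: abs_divide abs_mult)
      also have "3 * \<sigma> * (5 / 2 * ((x / (3 * \<sigma>))\<^sup>2 - (x / (3 * \<sigma>)) ^ 4)) =
        5 / (6 * \<sigma>) * x\<^sup>2 + (- 5 / (54 * \<sigma> ^ 3)) * x ^ 4"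
        using \<sigma> by (simp add: field_simps power2_eq_square power3_eq_cube power4_eq_xxxx)
      finally show ?thesis .
    qed
    have "sign_avg n (\<lambda>s. 5 / (6 * \<sigma>) * (\<Sum>j<n. a j * s j)\<^sup>2
        + (- 5 / (54 * \<sigma> ^ 3)) * (\<Sum>j<n. a j * s j) ^ 4) \<le> A"
      unfolding A_def by (intro sign_avg_mono *)
    then have "5 / (6 * \<sigma>) * v + (- 5 / (54 * \<sigma> ^ 3)) *
        sign_avg n (\<lambda>s. (\<Sum>j<n. a j * s j) ^ 4) \<le> A"
      by (simp only: sign_avg_add sign_avg_cmult sign_avg_second_moment v_def)
    moreover have "(- 5 / (54 * \<sigma> ^ 3)) * (3 * v\<^sup>2) \<le>
        (- 5 / (54 * \<sigma> ^ 3)) * sign_avg n (\<lambda>s. (\<Sum>j<n. a j * s j) ^ 4)"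
      using \<sigma> sign_avg_fourth_moment_le[of n a, folded v_def]
      by (intro mult_left_mono_neg) auto
    moreover have "5 / (6 * \<sigma>) * v + (- 5 / (54 * \<sigma> ^ 3)) * (3 * v\<^sup>2) = 5 / 9 * \<sigma>"
      using \<sigma> by (simp add: field_simps power2_eq_square power3_eq_cube)
    ultimately have "5 / 9 * \<sigma> \<le> A" by linarith
    then have "\<sigma> \<le> 2 * A" using A0 by linarith
    then show ?thesis by (simp add: \<sigma>_def v_def A_def)
  qed
qed

text \<open>Cauchy-Schwarz against the all-ones vector; this is the source of the factor
  \<open>sqrt n\<close> in the final bound.\<close>

lemma khintchine_l1:
  "(\<Sum>j<n. \<bar>a j\<bar>) \<le> 2 * sqrt n * sign_avg n (\<lambda>s. \<bar>\<Sum>j<n. a j * s j\<bar>)"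
proof -
  have "(\<Sum>j<n. \<bar>a j\<bar>) \<le> sqrt n * sqrt (\<Sum>j<n. (a j)\<^sup>2)"
    using L2_set_mult_ineq[of "\<lambda>_. 1" a "{..<n}"]
    by (simp add: L2_set_def)
  also have "\<dots> \<le> sqrt n * (2 * sign_avg n (\<lambda>s. \<bar>\<Sum>j<n. a j * s j\<bar>))"
    by (intro mult_left_mono khintchine_l2) auto
  finally show ?thesis by (simp add: algebra_simps)
qed

text \<open>All rows are averaged over the same random signs \<open>t\<close>. For fixed
  \<open>t\<close>, taking \<open>s i\<close> as the sign of the i-th row sum turns the absolute row
  sums into a bilinear form; a vanishing row sum gets the coefficient 0, which |s i| \<le> 1
  admits.\<close>

lemma sum_abs_matrix_le:
  fixes a :: "nat \<Rightarrow> nat \<Rightarrow> real"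
  assumes "\<And>s t. (\<And>i. \<bar>s i\<bar> \<le> 1) \<Longrightarrow> (\<And>j. \<bar>t j\<bar> \<le> 1) \<Longrightarrow> (\<Sum>i<m. \<Sum>j<n. a i j * s i * t j) \<le> K"
  shows "(\<Sum>i<m. \<Sum>j<n. \<bar>a i j\<bar>) \<le> 2 * sqrt n * K"
proof -
  have "(\<Sum>i<m. \<Sum>j<n. \<bar>a i j\<bar>) \<le>
      (\<Sum>i<m. 2 * sqrt n * sign_avg n (\<lambda>t. \<bar>\<Sum>j<n. a i j * t j\<bar>))"
    by (intro sum_mono khintchine_l1)
  also have "\<dots> = 2 * sqrt n * sign_avg n (\<lambda>t. \<Sum>i<m. \<bar>\<Sum>j<n. a i j * t j\<bar>)"
    by (simp add: sign_avg_sum sum_distrib_left)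
  also have "\<dots> \<le> 2 * sqrt n * sign_avg n (\<lambda>_. K)"
  proof (intro mult_left_mono sign_avg_mono)
    fix t :: "nat \<Rightarrow> real" assume t: "\<And>j. t j \<in> {-1, 1}"
    have "(\<Sum>i<m. \<bar>\<Sum>j<n. a i j * t j\<bar>) =
        (\<Sum>i<m. \<Sum>j<n. a i j * sgn (\<Sum>j<n. a i j * t j) * t j)"
      by (simp add: abs_sgn sum_distrib_right mult_ac)
    also have "\<dots> \<le> K"
    proof (rule assms)
      show "\<bar>t j\<bar> \<le> 1" for j using t[of j] by auto
    qed (auto simp: sgn_if)
    finally show "(\<Sum>i<m. \<bar>\<Sum>j<n. a i j * t j\<bar>) \<le> K" .
  qed auto
  finally show ?thesis by (simp add: sign_avg_const)
qed

section \<open>Telescoping along the diagonals of a matrix\<close>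

lemma sum_diff_le_of_diagonal_le:
  fixes h l :: "nat \<Rightarrow> nat \<Rightarrow> real"
  assumes diag: "\<And>i j. Suc i < n \<Longrightarrow> Suc j < n \<Longrightarrow> h i j \<le> l (Suc i) (Suc j)"
    and h: "\<And>i j. i < n \<Longrightarrow> j < n \<Longrightarrow> h i j \<le> 1"
    and l: "\<And>i j. i < n \<Longrightarrow> j < n \<Longrightarrow> 0 \<le> l i j"
  shows "(\<Sum>i<n. \<Sum>j<n. h i j - l i j) \<le> 2 * real n"
proof (cases n)
  case (Suc m)
  have "(\<Sum>i<n. \<Sum>j<n. h i j) = (\<Sum>i<m. \<Sum>j<m. h i j) + (\<Sum>i<m. h i m) + (\<Sum>j<Suc m. h m j)"
    by (simp add: Suc sum.distrib)
  \<comment> \<open>Every entry off the last row and column is paid for by its diagonal successor.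
    The remaining m + (m + 1) = 2 n - 1 entries cost at most 1 each.\<close>
  also have "\<dots> \<le> (\<Sum>i<m. \<Sum>j<m. l (Suc i) (Suc j)) + (\<Sum>i<m. 1) + (\<Sum>j<Suc m. 1)"
    using diag h by (intro add_mono sum_mono) (auto simp: Suc)
  also have "\<dots> \<le> (\<Sum>i<m. \<Sum>j<m. l (Suc i) (Suc j)) + 2 * n"
    by (simp add: Suc)
  \<comment> \<open>The shifted indices miss the first row and column of \<open>l\<close>; their
    entries are nonnegative, so adding them back can only increase the sum.\<close>
  also have "(\<Sum>i<m. \<Sum>j<m. l (Suc i) (Suc j)) \<le> (\<Sum>i<n. \<Sum>j<n. l i j)"
  proof -
    have "(\<Sum>i<m. \<Sum>j<m. l (Suc i) (Suc j)) \<le> (\<Sum>i<m. \<Sum>j<n. l (Suc i) j)"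
      using l unfolding Suc sum.lessThan_Suc_shift by (intro sum_mono) (auto simp: Suc)
    also have "\<dots> \<le> (\<Sum>i<n. \<Sum>j<n. l i j)"
      using l sum.lessThan_Suc_shift[of "\<lambda>i. \<Sum>j<n. l i j" m]
      by (auto simp: Suc simp del: sum.lessThan_Suc intro!: sum_nonneg)
    finally show ?thesis .
  qed
  finally show ?thesis by (simp add: sum_subtractf)
qed simp

subsection \<open>Quantiles of a measurable linear order\<close>

context ordered_prob_space
begin

sublocale square: pair_prob_space M M ..

lemma order_into_space: "(x, y) \<in> r \<Longrightarrow> x \<in> space M \<and> y \<in> space M"
  using sets.sets_into_space[OF measurable_order] by (auto simp: space_pair_measure)

lemma order_trans: "(x, y) \<in> r \<Longrightarrow> (y, z) \<in> r \<Longrightarrow> (x, z) \<in> r"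
  using strict_linear_order unfolding strict_linear_order_on_def by (meson transD)

lemma order_irrefl: "(x, x) \<notin> r"
  using strict_linear_order by (auto simp: strict_linear_order_on_def irrefl_def)

lemma order_asym: "(x, y) \<in> r \<Longrightarrow> (y, x) \<notin> r"
  using order_trans[of x y x] order_irrefl by blast

lemma order_total: "x \<in> space M \<Longrightarrow> y \<in> space M \<Longrightarrow> x = y \<or> (x, y) \<in> r \<or> (y, x) \<in> r"
  using strict_linear_order by (auto simp: strict_linear_order_on_def total_on_def)

text \<open>The closed initial segment of \<open>x\<close>, written as the complement of a section
  of \<open>r\<close> so that it inherits measurability from \<open>r\<close>;
  \<open>at_least\<close> is its mirror image.\<close>

definition at_most :: "'a \<Rightarrow> 'a set" where
  "at_most x = {y \<in> space M. (x, y) \<notin> r}"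

definition at_least :: "'a \<Rightarrow> 'a set" where
  "at_least x = {y \<in> space M. (y, x) \<notin> r}"

lemma at_most_eq: "at_most x = space M - Pair x -` r"
  by (auto simp: at_most_def)

lemma at_least_eq: "at_least x = space M - (\<lambda>y. (y, x)) -` r"
  by (auto simp: at_least_def)

lemma sets_at_most [measurable]: "at_most x \<in> sets M"
  unfolding at_most_eq using sets_Pair1[OF measurable_order] by auto

lemma sets_at_least [measurable]: "at_least x \<in> sets M"
  unfolding at_least_eq using sets_Pair2[OF measurable_order] by auto

text \<open>Makes the points of the space measurable, so that the mass of an atom and a fraction of
  its indicator make sense.\<close>

lemma singleton_eq: "x \<in> space M \<Longrightarrow> {x} = at_most x \<inter> at_least x"
  using order_total[of x] order_irrefl[of x] by (auto simp: at_most_def at_least_def)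

lemma measurable_at_most: "(\<lambda>x. measure M (at_most x)) \<in> borel_measurable M"
proof -
  have "(\<lambda>x. 1 - measure M (Pair x -` r)) \<in> borel_measurable M"
    unfolding measure_def using square.measurable_emeasure_Pair1[OF measurable_order] by measurable
  then show ?thesis
    by (simp add: at_most_eq prob_compl sets_Pair1[OF measurable_order])
qed

lemma measurable_at_least: "(\<lambda>x. measure M (at_least x)) \<in> borel_measurable M"
proof -
  have "(\<lambda>x. 1 - measure M ((\<lambda>y. (y, x)) -` r)) \<in> borel_measurable M"
    unfolding measure_def using square.measurable_emeasure_Pair2[OF measurable_order] by measurable
  then show ?thesis
    by (simp add: at_least_eq prob_compl sets_Pair2[OF measurable_order])
qed

section \<open>Bounding the measure of a set by its initial segments\<close>

lemma at_most_mono: "(x, y) \<in> r \<Longrightarrow> at_most x \<subseteq> at_most y"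
  using order_trans[of x y] by (auto simp: at_most_def)

text \<open>By asymmetry \<open>B \<times> B\<close> is covered by its pairs with y not above x and
  their mirror images. The sections of the first set are null by hypothesis, so Fubini makes both
  sets null, and then \<open>B\<close> is null.\<close>

lemma measure_eq_0_of_null_initial_segments:
  assumes B [measurable]: "B \<in> sets M"
    and null: "\<And>x. x \<in> B \<Longrightarrow> measure M (B \<inter> at_most x) = 0"
  shows "measure M B = 0"
proof -
  have meas: "{z \<in> space (M \<Otimes>\<^sub>M M). \<not> (fst z \<in> B \<and> snd z \<in> B \<and> (fst z, snd z) \<notin> r)} \<in> sets (M \<Otimes>\<^sub>M M)"
  proof -
    have "{z \<in> space (M \<Otimes>\<^sub>M M). \<not> (fst z \<in> B \<and> snd z \<in> B \<and> (fst z, snd z) \<notin> r)}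
        = space (M \<Otimes>\<^sub>M M) - (B \<times> B - r)"
      by auto
    also have "\<dots> \<in> sets (M \<Otimes>\<^sub>M M)"
      using measurable_order by measurable
    finally show ?thesis .
  qed
  have 1: "AE x in M. AE y in M. \<not> (x \<in> B \<and> y \<in> B \<and> (x, y) \<notin> r)"
  proof (rule AE_I2)
    fix x assume "x \<in> space M"
    show "AE y in M. \<not> (x \<in> B \<and> y \<in> B \<and> (x, y) \<notin> r)"
    proof (cases "x \<in> B")
      case True
      then have "B \<inter> at_most x \<in> null_sets M"
        using null[of x] by (auto simp: null_sets_def emeasure_eq_measure)
      then have "AE y in M. y \<notin> B \<inter> at_most x" by (rule AE_not_in)
      then show ?thesis
        by (rule AE_mp) (auto simp: at_most_def)
    qed simp
  qed
  have "AE y in M. AE x in M. \<not> (x \<in> B \<and> y \<in> B \<and> (x, y) \<notin> r)"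
    using 1 square.AE_commute[OF meas] by simp
  with 1 have "AE x in M. AE y in M. \<not> (x \<in> B \<and> y \<in> B)"
  proof eventually_elim
    case (elim x)
    then show ?case by eventually_elim (use order_asym in blast)
  qed
  then have *: "AE x in M. x \<in> B \<longrightarrow> (AE y in M. y \<notin> B)"
    by eventually_elim (auto elim: eventually_mono)
  \<comment> \<open>If the claim failed, the conclusion inside \<open>*\<close> would be false, and
    \<open>*\<close> would say that almost no point lies in \<open>B\<close>, which is the
    claim.\<close>
  have "AE y in M. y \<notin> B"
  proof (cases "AE y in M. y \<notin> B")
    case False
    with * show ?thesis by simp
  qed
  then have "emeasure M B = 0"
    using AE_iff_null_sets[OF B] by (auto simp: null_sets_def)
  then show ?thesis by (simp add: measure_def)
qed

text \<open>\<open>A\<close> need not be exhausted by countably many of its initial segments.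
  Segments with measures approaching the supremum s have a union \<open>D\<close> of measure s; an
  initial segment of \<open>A - D\<close> has measure at most s - s = 0, so the previous lemma makes
  \<open>A - D\<close> null.\<close>

lemma measure_le_of_initial_segments:
  assumes A [measurable]: "A \<in> sets M" and "0 \<le> c"
    and le: "\<And>x. x \<in> A \<Longrightarrow> measure M (A \<inter> at_most x) \<le> c"
  shows "measure M A \<le> c"
proof (cases "A = {}")
  case False
  define g where "g x = measure M (A \<inter> at_most x)" for x
  define s where "s = Sup (g ` A)"
  have bdd: "bdd_above (g ` A)" using le by (auto simp: g_def bdd_above_def)
  have gs: "g x \<le> s" if "x \<in> A" for x
    unfolding s_def using that bdd by (intro cSup_upper) auto
  have "s \<le> c"
    unfolding s_def using False le by (intro cSup_least) (auto simp: g_def)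
  have "\<exists>x\<in>A. s - 1 / real (Suc k) < g x" for k
    using less_cSup_iff[of "g ` A" "s - 1 / real (Suc k)"] bdd False
    by (auto simp: s_def[symmetric])
  then obtain a where a: "\<And>k. a k \<in> A" "\<And>k. s - 1 / real (Suc k) < g (a k)"
    by metis
  have aM: "a k \<in> space M" for k using a(1) sets.sets_into_space[OF A] by auto
  define D where "D = (\<Union>k. A \<inter> at_most (a k))"
  \<comment> \<open>The points \<open>a k\<close> need not increase. The finite unions
    \<open>E k\<close> do, and each lies in a single segment because segments form a chain, so
    continuity from below applies.\<close>
  define E where "E k = (\<Union>i\<le>k. A \<inter> at_most (a i))" for k
  have [measurable]: "D \<in> sets M" "E k \<in> sets M" for k
    unfolding D_def E_def by measurable
  have E_sub: "\<exists>i. E k \<subseteq> A \<inter> at_most (a i)" for k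
  proof (induction k)
    case 0
    then show ?case by (auto simp: E_def)
  next
    case (Suc k)
    then obtain i where i: "E k \<subseteq> A \<inter> at_most (a i)" by blast
    have "E (Suc k) = E k \<union> A \<inter> at_most (a (Suc k))"
      by (auto simp: E_def le_Suc_eq)
    moreover have "at_most (a i) \<subseteq> at_most (a (Suc k)) \<or> at_most (a (Suc k)) \<subseteq> at_most (a i)"
      using order_total[OF aM[of i] aM[of "Suc k"]] at_most_mono by auto
    ultimately show ?case using i by blast
  qed
  have E_le: "measure M (E k) \<le> s" for k
  proof -
    obtain i where "E k \<subseteq> A \<inter> at_most (a i)" using E_sub by blast
    then have "measure M (E k) \<le> g (a i)"
      unfolding g_def by (intro finite_measure_mono) auto
    then show ?thesis using gs[OF a(1)[of i]] by simp
  qed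
  have "incseq E" unfolding E_def incseq_def by (auto intro: order.trans)
  then have "(\<lambda>k. measure M (E k)) \<longlonglongrightarrow> measure M (\<Union>k. E k)"
    by (intro finite_Lim_measure_incseq) auto
  moreover have "(\<Union>k. E k) = D" by (auto simp: D_def E_def)
  ultimately have D_le: "measure M D \<le> s"
    using E_le by (auto intro: LIMSEQ_le_const2)
  have D_ge: "s \<le> measure M D"
  proof (rule LIMSEQ_le_const2)
    show "(\<lambda>k. s - 1 / real (Suc k)) \<longlonglongrightarrow> s"
      using tendsto_diff[OF tendsto_const LIMSEQ_inverse_real_of_nat, of s]
      by (simp add: inverse_eq_divide)
    have "s - 1 / real (Suc k) \<le> measure M D" for k
    proof -
      have "g (a k) \<le> measure M D"
        unfolding g_def by (intro finite_measure_mono) (auto simp: D_def)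
      then show ?thesis using a(2)[of k] by simp
    qed
    then show "\<exists>N. \<forall>k\<ge>N. s - 1 / real (Suc k) \<le> measure M D" by blast
  qed
  have "measure M (A - D) = 0"
  proof (rule measure_eq_0_of_null_initial_segments)
    fix x assume x: "x \<in> A - D"
    \<comment> \<open>A point outside \<open>D\<close> lies above every \<open>a k\<close>, so its
      segment contains all of \<open>D\<close>.\<close>
    have "(a k, x) \<in> r" for k
      using x sets.sets_into_space[OF A] by (auto simp: D_def at_most_def)
    then have sub: "D \<subseteq> A \<inter> at_most x"
      using at_most_mono by (force simp: D_def)
    have "measure M ((A - D) \<inter> at_most x) = measure M ((A \<inter> at_most x) - D)"
      by (rule arg_cong[where f="measure M"]) auto
    also have "\<dots> = g x - measure M D"
      unfolding g_def using sub by (intro finite_measure_Diff) auto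
    also have "\<dots> \<le> 0" using gs[of x] x D_ge by simp
    finally show "measure M ((A - D) \<inter> at_most x) = 0"
      by (simp add: measure_le_0_iff)
  qed auto
  moreover have "measure M (A - D) = measure M A - measure M D"
    by (intro finite_measure_Diff) (auto simp: D_def)
  ultimately show ?thesis using D_le \<open>s \<le> c\<close> by simp
qed (use \<open>0 \<le> c\<close> in simp)

text \<open>Order reversal transfers results on initial segments to final ones.\<close>

lemma ordered_prob_space_converse: "ordered_prob_space M (r\<inverse>)"
proof
  show "strict_linear_order_on (space M) (r\<inverse>)"
    using strict_linear_order by (auto simp: strict_linear_order_on_def irrefl_def)
  have "r\<inverse> = (\<lambda>(x, y). (y, x)) -` r \<inter> space (M \<Otimes>\<^sub>M M)"
    using order_into_space by (auto simp: space_pair_measure)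
  also have "\<dots> \<in> sets (M \<Otimes>\<^sub>M M)"
    using measurable_order measurable_pair_swap' by (auto intro: measurable_sets)
  finally show "r\<inverse> \<in> sets (M \<Otimes>\<^sub>M M)" .
qed

lemma measure_le_of_final_segments:
  assumes "A \<in> sets M" "0 \<le> c"
    and "\<And>x. x \<in> A \<Longrightarrow> measure M (A \<inter> at_least x) \<le> c"
  shows "measure M A \<le> c"
proof -
  interpret C: ordered_prob_space M "r\<inverse>" by (rule ordered_prob_space_converse)
  have "C.at_most x = at_least x" for x
    unfolding C.at_most_def at_least_def by simp
  with assms(3) show ?thesis
    by (intro C.measure_le_of_initial_segments[OF assms(1,2)]) simp
qed

text \<open>An initial segment of which the last point may be taken with a fractional weight;
  fractional weights are what makes arbitrary quantiles available in the presence of atoms.\<close>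

definition fuzzy_initial :: "('a \<Rightarrow> real) \<Rightarrow> bool" where
  "fuzzy_initial f \<longleftrightarrow> f \<in> borel_measurable M \<and> f \<in> space M \<rightarrow> {0..1} \<and>
     (\<forall>x y. (x, y) \<in> r \<longrightarrow> 0 < f y \<longrightarrow> f x = 1)"

lemma fuzzy_initial_integrable: "fuzzy_initial f \<Longrightarrow> integrable M f"
  by (rule integrable_const_bound[of _ 1]) (auto simp: fuzzy_initial_def Pi_iff)

section \<open>Existence and comparison of fractional quantiles\<close>

lemma at_most_disjoint_at_least:
  assumes "(x, y) \<in> r"
  shows "measure M (at_most x) + measure M (at_least y) \<le> 1"
proof -
  have "at_most x \<inter> at_least y = {}"
  proof -
    have False if "z \<in> space M" "(x, z) \<notin> r" "(z, y) \<notin> r" for z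
      using order_total[of x z] order_into_space[OF assms] order_trans[OF _ assms, of z] assms that
      by auto
    then show ?thesis by (auto simp: at_most_def at_least_def)
  qed
  then have "measure M (at_most x) + measure M (at_least y) = measure M (at_most x \<union> at_least y)"
    by (simp add: finite_measure_Union)
  then show ?thesis by (simp add: prob_le_1)
qed

text \<open>If \<open>A\<close> and \<open>B\<close> cover the space, their bounds c and 1 - c are
  attained and \<open>A\<close> itself is the quantile. Otherwise a point z outside both is an atom
  at which the cumulative measure jumps across c, and the fraction of z that completes the mass to c
  is added to the segment below z.\<close>

lemma exists_fuzzy_quantile:
  assumes c: "0 < c" "c < 1"
  shows "\<exists>f. fuzzy_initial f \<and> integral\<^sup>L M f = c"
proof -
  define A where "A = {x \<in> space M. measure M (at_most x) \<le> c}"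
  define B where "B = {x \<in> space M. measure M (at_least x) \<le> 1 - c}"
  have [measurable]: "A \<in> sets M" "B \<in> sets M"
    unfolding A_def B_def using measurable_at_most measurable_at_least by measurable
  have A_down: "x \<in> A" if "(x, y) \<in> r" "y \<in> A" for x y
    using that at_most_mono[OF that(1)] finite_measure_mono[of "at_most x" "at_most y"]
      order_into_space[OF that(1)] by (auto simp: A_def)
  have A_le: "measure M A \<le> c"
  proof (rule measure_le_of_initial_segments)
    fix x assume "x \<in> A"
    then show "measure M (A \<inter> at_most x) \<le> c"
      using finite_measure_mono[of "A \<inter> at_most x" "at_most x"] by (auto simp: A_def)
  qed (use c in auto)
  have B_le: "measure M B \<le> 1 - c"
  proof (rule measure_le_of_final_segments)
    fix x assume "x \<in> B"
    then show "measure M (B \<inter> at_least x) \<le> 1 - c"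
      using finite_measure_mono[of "B \<inter> at_least x" "at_least x"] by (auto simp: B_def)
  qed (use c in auto)
  show ?thesis
  proof (cases "A \<union> B = space M")
    case True
    have "1 \<le> measure M A + measure M B"
      using measure_Un_le[of A M B] True by (simp add: prob_space)
    with A_le B_le have "measure M A = c" by simp
    moreover have "fuzzy_initial (indicator A)"
      using A_down by (auto simp: fuzzy_initial_def indicator_def)
    ultimately show ?thesis by (intro exI[of _ "indicator A"]) simp
  next
    case False
    then obtain z where z: "z \<in> space M" "z \<notin> A" "z \<notin> B"
      using sets.sets_into_space[of A M] sets.sets_into_space[of B M] by auto
    \<comment> \<open>The final segment of z has measure above 1 - c, which leaves less than c for
      the initial segment of any x before z.\<close>
    have below: "x \<in> A" if "(x, z) \<in> r" for x
      using at_most_disjoint_at_least[OF that] order_into_space[OF that] z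
      by (auto simp: A_def B_def)
    have above: "x \<notin> A" if "(z, x) \<in> r" for x
      using A_down[OF that] z by blast
    have A_eq: "A = space M - at_least z"
      using below above z order_total[OF z(1)] by (auto simp: A_def at_least_def)
    have most_eq: "at_most z = A \<union> {z}"
      using below above z order_total[OF z(1)] order_asym order_irrefl
      by (auto simp: A_eq at_most_def at_least_def)
    have [measurable]: "{z} \<in> sets M" using singleton_eq[OF z(1)] by simp
    define p where "p = measure M {z}"
    have A_lt: "measure M A < c"
      using z by (simp add: A_eq prob_compl B_def)
    have "measure M (at_most z) = measure M A + p"
      unfolding most_eq p_def using z by (intro finite_measure_Union) auto
    then have p: "c < measure M A + p" using z by (auto simp: A_def)
    define \<theta> where "\<theta> = (c - measure M A) / p"
    have "p > 0" using p A_lt by simp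
    then have \<theta>: "0 \<le> \<theta>" "\<theta> \<le> 1" "\<theta> * p = c - measure M A"
      using p A_lt by (auto simp: \<theta>_def field_simps)
    define f where "f x = indicator A x + \<theta> * indicator {z} x" for x
    have "fuzzy_initial f"
      unfolding fuzzy_initial_def
    proof (intro conjI allI impI)
      show "f \<in> borel_measurable M" unfolding f_def by measurable
      show "f \<in> space M \<rightarrow> {0..1}" using \<theta> z by (auto simp: f_def indicator_def)
      fix x y assume xy: "(x, y) \<in> r" "0 < f y"
      then have "y \<in> A \<or> y = z" by (auto simp: f_def indicator_def split: if_splits)
      then have "x \<in> A" using xy(1) below A_down by auto
      then show "f x = 1" using z by (auto simp: f_def indicator_def)
    qed
    moreover have "integral\<^sup>L M f = c"
    proof -
      have "integrable M (indicat_real X)" if "X \<in> sets M" for X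
        using that by (intro integrable_const_bound[of _ 1]) auto
      then have "integral\<^sup>L M f = measure M A + \<theta> * p"
        unfolding f_def p_def by (subst Bochner_Integration.integral_add) auto
      then show ?thesis using \<theta> by simp
    qed
    ultimately show ?thesis by blast
  qed
qed

text \<open>If f x > g x, then f x > 0 and g x < 1, so f is 1 below x and g vanishes above x: f
  dominates g everywhere, against the integrals. Strictness thus gives a pointwise comparison
  without an exceptional null set.\<close>

lemma fuzzy_initial_le:
  assumes f: "fuzzy_initial f" and g: "fuzzy_initial g"
    and lt: "integral\<^sup>L M f < integral\<^sup>L M g" and x: "x \<in> space M"
  shows "f x \<le> g x"
proof (rule ccontr)
  assume "\<not> f x \<le> g x"
  then have gt: "g x < f x" by simp
  have fx: "0 < f x" "g x < 1"
    using gt f g x by (auto simp: fuzzy_initial_def Pi_iff)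
  have "g y \<le> f y" if y: "y \<in> space M" for y
  proof -
    consider "y = x" | "(y, x) \<in> r" | "(x, y) \<in> r" using order_total x y by blast
    then show ?thesis
    proof cases
      case 1
      then show ?thesis using gt by simp
    next
      case 2
      then have "f y = 1" using f fx by (auto simp: fuzzy_initial_def)
      then show ?thesis using g y by (auto simp: fuzzy_initial_def Pi_iff)
    next
      case 3
      then have "\<not> 0 < g y" using g fx by (auto simp: fuzzy_initial_def)
      moreover have "0 \<le> f y" using f y by (auto simp: fuzzy_initial_def Pi_iff)
      ultimately show ?thesis by simp
    qed
  qed
  then have "integral\<^sup>L M g \<le> integral\<^sup>L M f"
    using f g by (intro integral_mono fuzzy_initial_integrable)
  with lt show False by simp
qed

text \<open>The weights are differences of consecutive k/n quantiles. Consecutive intervals may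
  share a split atom, hence the reflexive closure in the last property.\<close>

lemma exists_ordered_partition_of_unity:
  assumes n: "0 < n"
  obtains \<phi> :: "nat \<Rightarrow> 'a \<Rightarrow> real" where
    "\<And>k. \<phi> k \<in> borel_measurable M"
    "\<And>k x. k < n \<Longrightarrow> x \<in> space M \<Longrightarrow> 0 \<le> \<phi> k x"
    "\<And>x. x \<in> space M \<Longrightarrow> (\<Sum>k<n. \<phi> k x) = 1"
    "\<And>k. k < n \<Longrightarrow> integral\<^sup>L M (\<phi> k) = 1 / n"
    "\<And>k x y. Suc k < n \<Longrightarrow> x \<in> space M \<Longrightarrow> y \<in> space M \<Longrightarrow> 0 < \<phi> k x \<Longrightarrow> 0 < \<phi> (Suc k) y \<Longrightarrow>
      (x, y) \<in> r\<^sup>="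
proof -
  \<comment> \<open>Beyond \<open>n\<close> the integral is capped at 1, so that a function exists
    for every \<open>k\<close>. The end quantiles are fixed as constants to make the telescoping sum
    1 at every point, not just almost everywhere.\<close>
  have "\<exists>f. fuzzy_initial f \<and> integral\<^sup>L M f = min 1 (k / n) \<and>
      (k = 0 \<longrightarrow> f = (\<lambda>_. 0)) \<and> (k = n \<longrightarrow> f = (\<lambda>_. 1))" for k
  proof -
    consider "k = 0" | "k \<noteq> 0" "k < n" | "k \<ge> n" by linarith
    then show ?thesis
    proof cases
      case 1
      then show ?thesis using n by (intro exI[of _ "\<lambda>_. 0"]) (auto simp: fuzzy_initial_def)
    next
      case 2
      then have "0 < k / n" "k / n < 1" by (auto simp: field_simps)
      then show ?thesis using exists_fuzzy_quantile[of "k / n"] 2 by auto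
    next
      case 3
      then have "1 \<le> k / n" using n by (auto simp: field_simps)
      then show ?thesis using n 3
        by (intro exI[of _ "\<lambda>_. 1"]) (auto simp: fuzzy_initial_def prob_space)
    qed
  qed
  then obtain q where q: "\<And>k. fuzzy_initial (q k)" "\<And>k. integral\<^sup>L M (q k) = min 1 (k / n)"
    "q 0 = (\<lambda>_. 0)" "q n = (\<lambda>_. 1)"
    by metis
  have int: "integral\<^sup>L M (q k) = k / n" if "k \<le> n" for k
    using q(2)[of k] that n by (auto simp: min_def field_simps)
  have [measurable]: "q k \<in> borel_measurable M" for k using q(1) by (auto simp: fuzzy_initial_def)
  define \<phi> where "\<phi> k x = q (Suc k) x - q k x" for k x
  show ?thesis
  proof
    show "\<phi> k \<in> borel_measurable M" for k unfolding \<phi>_def by measurable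
    show "0 \<le> \<phi> k x" if "k < n" "x \<in> space M" for k x
      unfolding \<phi>_def using that n
      by (simp, intro fuzzy_initial_le q) (auto simp: int divide_strict_right_mono)
    show "(\<Sum>k<n. \<phi> k x) = 1" if "x \<in> space M" for x
      unfolding \<phi>_def by (subst sum_lessThan_telescope) (simp add: q)
    show "integral\<^sup>L M (\<phi> k) = 1 / n" if "k < n" for k
    proof -
      have "integral\<^sup>L M (\<phi> k) = integral\<^sup>L M (q (Suc k)) - integral\<^sup>L M (q k)"
        unfolding \<phi>_def by (intro Bochner_Integration.integral_diff fuzzy_initial_integrable q)
      then show ?thesis using that by (simp add: int diff_divide_distrib[symmetric])
    qed
    show "(x, y) \<in> r\<^sup>=" if "Suc k < n" "x \<in> space M" "y \<in> space M" "0 < \<phi> k x" "0 < \<phi> (Suc k) y" for k x y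
    \<comment> \<open>If y preceded x, the positive value \<open>q (Suc k) x\<close> would force
      \<open>q (Suc k) y = 1\<close>, leaving no weight for \<open>\<phi> (Suc k) y\<close>.\<close>
    proof (rule ccontr)
      assume "(x, y) \<notin> r\<^sup>="
      then have "(y, x) \<in> r" using order_total that by blast
      moreover have "0 < q (Suc k) x"
        using q(1)[of k] that by (auto simp: \<phi>_def fuzzy_initial_def Pi_iff)
      ultimately have "q (Suc k) y = 1"
        using q(1)[of "Suc k"] by (auto simp: fuzzy_initial_def)
      moreover have "q (Suc (Suc k)) y \<le> 1"
        using q(1)[of "Suc (Suc k)"] that by (auto simp: fuzzy_initial_def Pi_iff)
      ultimately show False using that by (simp add: \<phi>_def)
    qed
  qed
qed

end

subsection \<open>Cut norm and cell averages\<close>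

text \<open>If 0 is not strictly between \<open>l\<close> and \<open>h\<close>, then
  \<open>f\<close> keeps its sign where \<open>w\<close> is positive and the absolute value moves
  outside the integral at no cost. Otherwise |f| itself is at most h - l there.\<close>

lemma integral_abs_le_abs_integral_oscillation:
  fixes f w :: "'b \<Rightarrow> real"
  assumes f: "integrable N (\<lambda>z. f z * w z)" and w: "integrable N w"
    and nonneg: "\<And>z. z \<in> space N \<Longrightarrow> 0 \<le> w z"
    and range: "\<And>z. z \<in> space N \<Longrightarrow> 0 < w z \<Longrightarrow> f z \<in> {l..h}" and "l \<le> h"
  shows "(\<integral>z. \<bar>f z\<bar> * w z \<partial>N) \<le> \<bar>\<integral>z. f z * w z \<partial>N\<bar> + (h - l) * integral\<^sup>L N w"
proof -
  have w0: "0 \<le> integral\<^sup>L N w" using nonneg by (intro Bochner_Integration.integral_nonneg)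
  have eq: "(\<integral>z. \<bar>f z\<bar> * w z \<partial>N) = (\<integral>z. \<bar>f z * w z\<bar> \<partial>N)"
    using nonneg by (intro Bochner_Integration.integral_cong) (auto simp: abs_mult)
  consider "0 \<le> l" | "h \<le> 0" | "l < 0" "0 < h" by linarith
  then show ?thesis
  proof cases
    case 1
    have "0 \<le> f z * w z" if "z \<in> space N" for z
      using 1 range[OF that] nonneg[OF that] by (cases "w z = 0") auto
    then have "(\<integral>z. \<bar>f z * w z\<bar> \<partial>N) = (\<integral>z. f z * w z \<partial>N)"
      by (intro Bochner_Integration.integral_cong) auto
    then show ?thesis using eq w0 \<open>l \<le> h\<close> by (simp add: add_increasing2)
  next
    case 2
    have "f z * w z \<le> 0" if "z \<in> space N" for z
      using 2 range[OF that] nonneg[OF that] by (cases "w z = 0") (auto intro: mult_nonpos_nonneg)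
    then have "(\<integral>z. \<bar>f z * w z\<bar> \<partial>N) = (\<integral>z. - (f z * w z) \<partial>N)"
      by (intro Bochner_Integration.integral_cong) auto
    then have "(\<integral>z. \<bar>f z * w z\<bar> \<partial>N) \<le> \<bar>\<integral>z. f z * w z \<partial>N\<bar>" by simp
    moreover have "0 \<le> (h - l) * integral\<^sup>L N w" using w0 \<open>l \<le> h\<close> by simp
    ultimately show ?thesis using eq by simp
  next
    case 3
    have "\<bar>f z * w z\<bar> \<le> (h - l) * w z" if "z \<in> space N" for z
    proof (cases "w z = 0")
      case False
      then have "0 < w z" using nonneg[OF that] by simp
      with range[OF that] 3 have "\<bar>f z\<bar> \<le> h - l" by auto
      then show ?thesis using \<open>0 < w z\<close> by (simp add: abs_mult)
    qed simp
    then have "(\<integral>z. \<bar>f z * w z\<bar> \<partial>N) \<le> (\<integral>z. (h - l) * w z \<partial>N)"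
      using f w by (intro integral_mono) auto
    then show ?thesis using eq by simp
  qed
qed

context ordered_prob_space
begin

section \<open>Test integrals and cell integrals against the cut norm\<close>

lemma integrable_square_bounded:
  assumes "U \<in> borel_measurable (M \<Otimes>\<^sub>M M)"
    and "\<And>x y. x \<in> space M \<Longrightarrow> y \<in> space M \<Longrightarrow> \<bar>U (x, y) :: real\<bar> \<le> B"
  shows "integrable (M \<Otimes>\<^sub>M M) U"
  using assms by (intro square.integrable_const_bound[of _ B]) (auto simp: space_pair_measure)

lemma abs_test_integral_le_1:
  fixes f g :: "'a \<Rightarrow> real"
  assumes [measurable]: "U \<in> borel_measurable (M \<Otimes>\<^sub>M M)" "f \<in> borel_measurable M" "g \<in> borel_measurable M"
    and U: "\<And>x y. x \<in> space M \<Longrightarrow> y \<in> space M \<Longrightarrow> \<bar>U (x, y)\<bar> \<le> 1"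
    and fg: "f \<in> space M \<rightarrow> {-1..1}" "g \<in> space M \<rightarrow> {-1..1}"
  shows "\<bar>\<integral>(x, y). U (x, y) * f x * g y \<partial>(M \<Otimes>\<^sub>M M)\<bar> \<le> 1"
proof -
  have le: "\<bar>U (x, y) * f x * g y\<bar> \<le> 1" if "x \<in> space M" "y \<in> space M" for x y
  proof -
    have "\<bar>f x\<bar> \<le> 1" "\<bar>g y\<bar> \<le> 1" using Pi_mem[OF fg(1) that(1)] Pi_mem[OF fg(2) that(2)] by auto
    then have "\<bar>U (x, y)\<bar> * \<bar>f x\<bar> * \<bar>g y\<bar> \<le> 1 * 1 * 1"
      using U that by (intro mult_mono) auto
    then show ?thesis by (simp add: abs_mult)
  qed
  have "\<bar>\<integral>(x, y). U (x, y) * f x * g y \<partial>(M \<Otimes>\<^sub>M M)\<bar> \<le>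
      (\<integral>z. \<bar>case z of (x, y) \<Rightarrow> U (x, y) * f x * g y\<bar> \<partial>(M \<Otimes>\<^sub>M M))"
    by (rule integral_abs_bound)
  also have "\<dots> \<le> (\<integral>z. 1 \<partial>(M \<Otimes>\<^sub>M M))"
    using le by (intro integral_mono integrable_square_bounded[of _ 1]) (auto simp: space_pair_measure)
  finally show ?thesis by (simp add: square.prob_space)
qed

context
  fixes U :: "'a \<times> 'a \<Rightarrow> real"
  assumes U_meas [measurable]: "U \<in> borel_measurable (M \<Otimes>\<^sub>M M)"
    and U_le: "\<And>x y. x \<in> space M \<Longrightarrow> y \<in> space M \<Longrightarrow> \<bar>U (x, y)\<bar> \<le> 1"
begin

lemma test_integral_le_cut_norm:
  assumes "f \<in> borel_measurable M" "f \<in> space M \<rightarrow> {-1..1}"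
    and "g \<in> borel_measurable M" "g \<in> space M \<rightarrow> {-1..1}"
  shows "\<bar>\<integral>(x, y). U (x, y) * f x * g y \<partial>(M \<Otimes>\<^sub>M M)\<bar> \<le> cut_norm M U"
  unfolding cut_norm_def
proof (rule cSup_upper)
  show "bdd_above {\<bar>\<integral>(x, y). U (x, y) * f x * g y \<partial>(M \<Otimes>\<^sub>M M)\<bar> | f g.
      f \<in> borel_measurable M \<and> f \<in> space M \<rightarrow> {-1..1} \<and>
      g \<in> borel_measurable M \<and> g \<in> space M \<rightarrow> {-1..1}}"
    using abs_test_integral_le_1 U_le U_meas by (intro bdd_aboveI[of _ 1]) blast
qed (use assms in blast)

lemma cut_norm_nonneg: "0 \<le> cut_norm M U"
  by (rule order.trans[OF abs_ge_zero test_integral_le_cut_norm[of "\<lambda>_. 0" "\<lambda>_. 0"]]) auto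

text \<open>Keeps the ideal number of intervals at least 1, so that rounding it up at most doubles
  it.\<close>

lemma cut_norm_le_1: "cut_norm M U \<le> 1"
  unfolding cut_norm_def
proof (rule cSup_least)
  have "(\<lambda>_. 0) \<in> borel_measurable M" "(\<lambda>_. 0) \<in> space M \<rightarrow> {-1..1::real}" by auto
  then show "{\<bar>\<integral>(x, y). U (x, y) * f x * g y \<partial>(M \<Otimes>\<^sub>M M)\<bar> | f g.
      f \<in> borel_measurable M \<and> f \<in> space M \<rightarrow> {-1..1} \<and>
      g \<in> borel_measurable M \<and> g \<in> space M \<rightarrow> {-1..1}} \<noteq> {}"
    by blast
qed (use abs_test_integral_le_1 U_le U_meas in blast)

text \<open>The bilinear form of the cell integrals in \<open>s\<close> and \<open>t\<close> is the
  test integral of \<open>U\<close> against the combinations of the \<open>\<phi> k\<close> with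
  coefficients \<open>s\<close> and \<open>t\<close>. A partition of unity keeps these in [-1, 1],
  so the cut norm is an admissible \<open>K\<close> in \<open>sum_abs_matrix_le\<close>.\<close>

lemma sum_abs_cell_integrals_le:
  fixes \<phi> :: "nat \<Rightarrow> 'a \<Rightarrow> real" and n :: nat
  assumes \<phi> [measurable]: "\<And>k. \<phi> k \<in> borel_measurable M"
    and nonneg: "\<And>k x. k < n \<Longrightarrow> x \<in> space M \<Longrightarrow> 0 \<le> \<phi> k x"
    and sum1: "\<And>x. x \<in> space M \<Longrightarrow> (\<Sum>k<n. \<phi> k x) = 1"
  shows "(\<Sum>i<n. \<Sum>j<n. \<bar>\<integral>(x, y). U (x, y) * (\<phi> i x * \<phi> j y) \<partial>(M \<Otimes>\<^sub>M M)\<bar>) \<le> 2 * sqrt n * cut_norm M U"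
proof (rule sum_abs_matrix_le)
  fix s t :: "nat \<Rightarrow> real"
  assume s: "\<And>i. \<bar>s i\<bar> \<le> 1" and t: "\<And>i. \<bar>t i\<bar> \<le> 1"
  have le1: "\<phi> k x \<le> 1" if "k < n" "x \<in> space M" for k x
    using member_le_sum[of k "{..<n}" "\<lambda>k. \<phi> k x"] nonneg sum1 that by auto
  have int: "integrable (M \<Otimes>\<^sub>M M) (\<lambda>(x, y). U (x, y) * (\<phi> i x * \<phi> j y))" if "i < n" "j < n" for i j
  proof (rule integrable_square_bounded[of _ 1])
    fix x y assume xy: "x \<in> space M" "y \<in> space M"
    have "\<bar>U (x, y)\<bar> * (\<phi> i x * \<phi> j y) \<le> 1 * (1 * 1)"
      using xy that U_le nonneg le1 by (intro mult_mono) auto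
    then show "\<bar>case (x, y) of (x, y) \<Rightarrow> U (x, y) * (\<phi> i x * \<phi> j y)\<bar> \<le> 1"
      using nonneg that xy by (simp add: abs_mult)
  qed measurable
  define f where "f u x = (\<Sum>i<n. u i * \<phi> i x)" for u :: "nat \<Rightarrow> real" and x
  have f_range: "f u \<in> space M \<rightarrow> {-1..1}" if u: "\<And>i. \<bar>u i\<bar> \<le> 1" for u
  proof
    fix x assume x: "x \<in> space M"
    have "\<bar>f u x\<bar> \<le> (\<Sum>i<n. \<bar>u i * \<phi> i x\<bar>)" unfolding f_def by (rule sum_abs)
    also have "\<dots> \<le> (\<Sum>i<n. \<phi> i x)"
      using nonneg x u by (intro sum_mono) (auto simp: abs_mult intro: mult_left_le_one_le)
    finally show "f u x \<in> {-1..1}" using sum1[OF x] by auto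
  qed
  have [measurable]: "f u \<in> borel_measurable M" for u unfolding f_def by measurable
  let ?G = "\<lambda>i j z. (case z of (x, y) \<Rightarrow> U (x, y) * (\<phi> i x * \<phi> j y)) * s i * t j"
  have intG: "integrable (M \<Otimes>\<^sub>M M) (?G i j)" if "i < n" "j < n" for i j
    using int[OF that] by (intro integrable_mult_left) auto
  have "(\<Sum>i<n. \<Sum>j<n. (\<integral>(x, y). U (x, y) * (\<phi> i x * \<phi> j y) \<partial>(M \<Otimes>\<^sub>M M)) * s i * t j) =
      (\<Sum>i<n. \<Sum>j<n. \<integral>z. ?G i j z \<partial>(M \<Otimes>\<^sub>M M))"
    by (simp only: integral_mult_left_zero)
  also have "\<dots> = (\<Sum>i<n. \<integral>z. (\<Sum>j<n. ?G i j z) \<partial>(M \<Otimes>\<^sub>M M))"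
    using intG by (intro sum.cong refl Bochner_Integration.integral_sum[symmetric]) auto
  also have "\<dots> = (\<integral>z. (\<Sum>i<n. \<Sum>j<n. ?G i j z) \<partial>(M \<Otimes>\<^sub>M M))"
    using intG by (intro Bochner_Integration.integral_sum[symmetric] Bochner_Integration.integrable_sum) auto
  also have "\<dots> = (\<integral>(x, y). U (x, y) * f s x * f t y \<partial>(M \<Otimes>\<^sub>M M))"
    by (intro Bochner_Integration.integral_cong)
      (auto simp: f_def sum_distrib_left sum_distrib_right mult_ac intro: sum.swap)
  also have "\<dots> \<le> cut_norm M U"
    using test_integral_le_cut_norm[of "f s" "f t"] f_range s t by (auto simp: abs_le_iff)
  finally show "(\<Sum>i<n. \<Sum>j<n. (\<integral>(x, y). U (x, y) * (\<phi> i x * \<phi> j y) \<partial>(M \<Otimes>\<^sub>M M)) * s i * t j)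
    \<le> cut_norm M U" .
qed

end

section \<open>The bound for a fixed number of intervals\<close>

lemma L1_norm_le:
  fixes n :: nat
  assumes W1: "monotone_kernel M r W1" and W2: "monotone_kernel M r W2" and n: "0 < n"
  shows "L1_norm (M \<Otimes>\<^sub>M M) (\<lambda>z. W1 z - W2 z) \<le> 4 / n + 2 * sqrt n * cut_norm M (\<lambda>z. W1 z - W2 z)"
proof -
  obtain \<phi> :: "nat \<Rightarrow> 'a \<Rightarrow> real" where \<phi> [measurable]: "\<And>k. \<phi> k \<in> borel_measurable M"
    and nonneg: "\<And>k x. k < n \<Longrightarrow> x \<in> space M \<Longrightarrow> 0 \<le> \<phi> k x"
    and sum1: "\<And>x. x \<in> space M \<Longrightarrow> (\<Sum>k<n. \<phi> k x) = 1"
    and int\<phi>: "\<And>k. k < n \<Longrightarrow> integral\<^sup>L M (\<phi> k) = 1 / n"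
    and ord: "\<And>k x y. Suc k < n \<Longrightarrow> x \<in> space M \<Longrightarrow> y \<in> space M \<Longrightarrow> 0 < \<phi> k x \<Longrightarrow> 0 < \<phi> (Suc k) y \<Longrightarrow>
      (x, y) \<in> r\<^sup>="
    using exists_ordered_partition_of_unity[OF n] by blast
  have le1: "\<phi> k x \<le> 1" if "k < n" "x \<in> space M" for k x
    using member_le_sum[of k "{..<n}" "\<lambda>k. \<phi> k x"] nonneg sum1 that by auto
  \<comment> \<open>Ensures that the cells are nonempty, so that their \<open>Sup\<close> and
    \<open>Inf\<close> are genuine bounds.\<close>
  have nonempty: "\<exists>x\<in>space M. 0 < \<phi> k x" if "k < n" for k
  proof (rule ccontr)
    assume "\<not> ?thesis"
    then have "integral\<^sup>L M (\<phi> k) = integral\<^sup>L M (\<lambda>_. 0)"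
      using nonneg[OF that] by (intro Bochner_Integration.integral_cong) force+
    then show False using int\<phi>[OF that] n by simp
  qed
  \<comment> \<open>Only points charged by both weights count. Since a split atom may belong to
    neighbouring intervals, cells can overlap.\<close>
  define cell where "cell W i j = {W (x, y) | x y. x \<in> space M \<and> y \<in> space M \<and> 0 < \<phi> i x \<and> 0 < \<phi> j y}"
    for W :: "'a \<times> 'a \<Rightarrow> real" and i j
  define hi where "hi W i j = Sup (cell W i j)" for W i j
  define lo where "lo W i j = Inf (cell W i j)" for W i j
  have cell_ne: "cell W i j \<noteq> {}" if ij: "i < n" "j < n" for W i j
  proof -
    obtain x y where "x \<in> space M" "0 < \<phi> i x" "y \<in> space M" "0 < \<phi> j y"
      using nonempty[OF ij(1)] nonempty[OF ij(2)] by auto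
    then have "W (x, y) \<in> cell W i j" by (auto simp: cell_def)
    then show ?thesis by auto
  qed
  have osc: "(\<Sum>i<n. \<Sum>j<n. hi W i j - lo W i j) \<le> 2 * real n"
    and hi: "\<And>v i j. v \<in> cell W i j \<Longrightarrow> v \<le> hi W i j"
    and lo: "\<And>v i j. v \<in> cell W i j \<Longrightarrow> lo W i j \<le> v"
    and W_meas: "W \<in> borel_measurable (M \<Otimes>\<^sub>M M)"
    and W01: "\<And>x y. x \<in> space M \<Longrightarrow> y \<in> space M \<Longrightarrow> 0 \<le> W (x, y) \<and> W (x, y) \<le> 1"
    if W: "monotone_kernel M r W" for W
  proof -
    show W_meas: "W \<in> borel_measurable (M \<Otimes>\<^sub>M M)"
      using W by (auto simp: monotone_kernel_def kernel_on_def)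
    show W01: "0 \<le> W (x, y) \<and> W (x, y) \<le> 1" if "x \<in> space M" "y \<in> space M" for x y
      using W that by (auto simp: monotone_kernel_def kernel_on_def)
    have cell01: "cell W i j \<subseteq> {0..1}" for i j using W01 by (auto simp: cell_def)
    have bdd: "bdd_above (cell W i j)" "bdd_below (cell W i j)" for i j
      using bdd_above_mono[OF _ cell01] bdd_below_mono[OF _ cell01] by auto
    show "v \<le> hi W i j" if "v \<in> cell W i j" for v i j
      unfolding hi_def using that bdd by (intro cSup_upper)
    show "lo W i j \<le> v" if "v \<in> cell W i j" for v i j
      unfolding lo_def using that bdd by (intro cInf_lower)
    show "(\<Sum>i<n. \<Sum>j<n. hi W i j - lo W i j) \<le> 2 * real n"
    proof (rule sum_diff_le_of_diagonal_le)
      fix i j assume ij: "Suc i < n" "Suc j < n"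
      show "hi W i j \<le> lo W (Suc i) (Suc j)"
        unfolding hi_def lo_def
      proof (intro cSup_least cInf_greatest cell_ne)
        fix u v assume "u \<in> cell W i j" "v \<in> cell W (Suc i) (Suc j)"
        then obtain x y x' y' where uv: "u = W (x, y)" "v = W (x', y')"
          and xy: "x \<in> space M" "y \<in> space M" "x' \<in> space M" "y' \<in> space M"
          and pos: "0 < \<phi> i x" "0 < \<phi> j y" "0 < \<phi> (Suc i) x'" "0 < \<phi> (Suc j) y'"
          unfolding cell_def by blast
        \<comment> \<open>Consecutive intervals are ordered in each coordinate, so monotonicity
          compares the two cells point by point.\<close>
        have "(x, x') \<in> r\<^sup>=" "(y, y') \<in> r\<^sup>="
          using ord[OF ij(1)] ord[OF ij(2)] xy pos by blast+
        then show "u \<le> v" using W xy unfolding uv monotone_kernel_def by blast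
      qed (use ij in auto)
    next
      fix i j assume ij: "i < n" "j < n"
      show "hi W i j \<le> 1"
        unfolding hi_def using cell_ne[OF ij] cell01 by (intro cSup_least) (auto simp: subset_iff)
      show "0 \<le> lo W i j"
        unfolding lo_def using cell_ne[OF ij] cell01 by (intro cInf_greatest) (auto simp: subset_iff)
    qed
  qed
  define U where "U z = W1 z - W2 z" for z
  note [measurable] = W_meas[OF W1] W_meas[OF W2]
  have U_meas [measurable]: "U \<in> borel_measurable (M \<Otimes>\<^sub>M M)" unfolding U_def by measurable
  have U_le: "\<bar>U (x, y)\<bar> \<le> 1" if "x \<in> space M" "y \<in> space M" for x y
    using W01[OF W1 that] W01[OF W2 that] by (auto simp: U_def)
  define w where "w i j z = \<phi> i (fst z) * \<phi> j (snd z)" for i j z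
  have [measurable]: "w i j \<in> borel_measurable (M \<Otimes>\<^sub>M M)" for i j unfolding w_def by measurable
  have w01: "0 \<le> w i j z" "w i j z \<le> 1" if "i < n" "j < n" "z \<in> space (M \<Otimes>\<^sub>M M)" for i j z
    using that nonneg le1 by (auto simp: w_def space_pair_measure intro: mult_le_one)
  have int_w: "integrable (M \<Otimes>\<^sub>M M) (w i j)" if "i < n" "j < n" for i j
    using w01 that by (intro integrable_square_bounded[of _ 1]) (auto simp: space_pair_measure)
  have int_Uw: "integrable (M \<Otimes>\<^sub>M M) (\<lambda>z. U z * w i j z)" if "i < n" "j < n" for i j
    using w01 that U_le
    by (intro integrable_square_bounded[of _ 1])
       (auto simp: space_pair_measure abs_mult intro!: mult_le_one)
  have w_total: "integral\<^sup>L (M \<Otimes>\<^sub>M M) (w i j) = 1 / (real n)\<^sup>2" if "i < n" "j < n" for i j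
  proof -
    have "integral\<^sup>L (M \<Otimes>\<^sub>M M) (w i j) = (\<integral>x. (\<integral>y. w i j (x, y) \<partial>M) \<partial>M)"
      using square.integral_fst'[OF int_w[OF that]] by simp
    also have "\<dots> = 1 / (real n)\<^sup>2"
      by (simp add: w_def int\<phi> that power2_eq_square)
    finally show ?thesis .
  qed
  \<comment> \<open>On a cell the difference lies between \<open>lo W1 - hi W2\<close> and
    \<open>hi W1 - lo W2\<close>; the length of this range is the sum of the two
    oscillations.\<close>
  have cell_le: "(\<integral>z. \<bar>U z\<bar> * w i j z \<partial>(M \<Otimes>\<^sub>M M)) \<le> \<bar>\<integral>z. U z * w i j z \<partial>(M \<Otimes>\<^sub>M M)\<bar>
      + ((hi W1 i j - lo W1 i j) + (hi W2 i j - lo W2 i j)) / (real n)\<^sup>2" if ij: "i < n" "j < n" for i j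
  proof -
    obtain v1 v2 where v: "v1 \<in> cell W1 i j" "v2 \<in> cell W2 i j" using cell_ne[OF ij] by blast
    have "(\<integral>z. \<bar>U z\<bar> * w i j z \<partial>(M \<Otimes>\<^sub>M M)) \<le> \<bar>\<integral>z. U z * w i j z \<partial>(M \<Otimes>\<^sub>M M)\<bar>
      + ((hi W1 i j - lo W2 i j) - (lo W1 i j - hi W2 i j)) * integral\<^sup>L (M \<Otimes>\<^sub>M M) (w i j)"
    proof (rule integral_abs_le_abs_integral_oscillation[OF int_Uw[OF ij] int_w[OF ij] w01(1)[OF ij]])
      fix z assume z: "z \<in> space (M \<Otimes>\<^sub>M M)" "0 < w i j z"
      then obtain x y where xy: "z = (x, y)" "x \<in> space M" "y \<in> space M"
        by (auto simp: space_pair_measure)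
      have "0 < \<phi> i x" "0 < \<phi> j y"
        using z(2) nonneg[OF ij(1) xy(2)] nonneg[OF ij(2) xy(3)]
        by (auto simp: w_def xy(1) zero_less_mult_iff)
      then have "W1 z \<in> cell W1 i j" "W2 z \<in> cell W2 i j" using xy unfolding cell_def by blast+
      then show "U z \<in> {lo W1 i j - hi W2 i j..hi W1 i j - lo W2 i j}"
        using hi[OF W1, of "W1 z"] hi[OF W2, of "W2 z"] lo[OF W1, of "W1 z"] lo[OF W2, of "W2 z"]
        by (auto simp: U_def intro: diff_mono)
    next
      show "lo W1 i j - hi W2 i j \<le> hi W1 i j - lo W2 i j"
        using hi[OF W1 v(1)] hi[OF W2 v(2)] lo[OF W1 v(1)] lo[OF W2 v(2)] by linarith
    qed
    then show ?thesis by (simp add: w_total[OF ij] algebra_simps add_divide_distrib diff_divide_distrib)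
  qed
  have "L1_norm (M \<Otimes>\<^sub>M M) U = (\<integral>z. (\<Sum>i<n. \<Sum>j<n. \<bar>U z\<bar> * w i j z) \<partial>(M \<Otimes>\<^sub>M M))"
    unfolding L1_norm_def
  proof (intro Bochner_Integration.integral_cong refl)
    fix z assume "z \<in> space (M \<Otimes>\<^sub>M M)"
    then have "(\<Sum>i<n. \<phi> i (fst z)) * (\<Sum>j<n. \<phi> j (snd z)) = 1"
      using sum1 by (auto simp: space_pair_measure)
    then show "\<bar>U z\<bar> = (\<Sum>i<n. \<Sum>j<n. \<bar>U z\<bar> * w i j z)"
      by (simp add: w_def sum_distrib_left[symmetric] sum_distrib_right[symmetric])
  qed
  also have "\<dots> = (\<Sum>i<n. \<Sum>j<n. \<integral>z. \<bar>U z\<bar> * w i j z \<partial>(M \<Otimes>\<^sub>M M))"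
  proof -
    have int: "integrable (M \<Otimes>\<^sub>M M) (\<lambda>z. \<bar>U z\<bar> * w i j z)" if "i < n" "j < n" for i j
      using w01 that U_le
      by (intro integrable_square_bounded[of _ 1])
         (auto simp: space_pair_measure abs_mult intro!: mult_le_one)
    have "(\<integral>z. (\<Sum>i<n. \<Sum>j<n. \<bar>U z\<bar> * w i j z) \<partial>(M \<Otimes>\<^sub>M M)) =
        (\<Sum>i<n. \<integral>z. (\<Sum>j<n. \<bar>U z\<bar> * w i j z) \<partial>(M \<Otimes>\<^sub>M M))"
      using int by (intro Bochner_Integration.integral_sum Bochner_Integration.integrable_sum) auto
    also have "\<dots> = (\<Sum>i<n. \<Sum>j<n. \<integral>z. \<bar>U z\<bar> * w i j z \<partial>(M \<Otimes>\<^sub>M M))"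
      using int by (intro sum.cong refl Bochner_Integration.integral_sum) auto
    finally show ?thesis .
  qed
  also have "\<dots> \<le> (\<Sum>i<n. \<Sum>j<n. \<bar>\<integral>z. U z * w i j z \<partial>(M \<Otimes>\<^sub>M M)\<bar>
      + ((hi W1 i j - lo W1 i j) + (hi W2 i j - lo W2 i j)) / (real n)\<^sup>2)"
    using cell_le by (intro sum_mono) auto
  also have "\<dots> = (\<Sum>i<n. \<Sum>j<n. \<bar>\<integral>z. U z * w i j z \<partial>(M \<Otimes>\<^sub>M M)\<bar>) +
     ((\<Sum>i<n. \<Sum>j<n. hi W1 i j - lo W1 i j) + (\<Sum>i<n. \<Sum>j<n. hi W2 i j - lo W2 i j)) / (real n)\<^sup>2"
    by (simp only: sum.distrib sum_divide_distrib add_divide_distrib)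
  \<comment> \<open>Khintchine controls the first sum. The oscillations of each kernel add up to at
    most 2 n and are weighted by the cell mass 1 / n^2.\<close>
  also have "\<dots> \<le> 2 * sqrt n * cut_norm M U + (2 * real n + 2 * real n) / (real n)\<^sup>2"
  proof (intro add_mono divide_right_mono osc W1 W2)
    show "(\<Sum>i<n. \<Sum>j<n. \<bar>\<integral>z. U z * w i j z \<partial>(M \<Otimes>\<^sub>M M)\<bar>) \<le> 2 * sqrt n * cut_norm M U"
      using sum_abs_cell_integrals_le[OF U_meas U_le \<phi> nonneg sum1]
      by (simp add: w_def case_prod_unfold)
  qed simp
  also have "(2 * real n + 2 * real n) / (real n)\<^sup>2 = 4 / n"
    using n by (simp add: power2_eq_square field_simps)
  finally show ?thesis by (simp add: U_def[abs_def])
qed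

end

section \<open>Balancing the two errors by the number of intervals\<close>

theorem theorem5p5:
  fixes M :: "'a measure" and r :: "'a rel" and W1 W2 :: "'a \<times> 'a \<Rightarrow> real"
  assumes "ordered_prob_space M r"
    and "monotone_kernel M r W1"
    and "monotone_kernel M r W2"
  shows "L1_norm (M \<Otimes>\<^sub>M M) (\<lambda>z. W1 z - W2 z)
           \<le> 10 * cut_norm M (\<lambda>z. W1 z - W2 z) powr (2 / 3)"
proof -
  interpret ordered_prob_space M r by (rule assms(1))
  define U where "U = (\<lambda>z. W1 z - W2 z)"
  define L where "L = L1_norm (M \<Otimes>\<^sub>M M) U"
  define d where "d = cut_norm M U"
  have "W1 \<in> borel_measurable (M \<Otimes>\<^sub>M M)" "W2 \<in> borel_measurable (M \<Otimes>\<^sub>M M)"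
    using assms(2,3) by (auto simp: monotone_kernel_def kernel_on_def)
  then have U: "U \<in> borel_measurable (M \<Otimes>\<^sub>M M)" unfolding U_def by measurable
  have U_le: "\<bar>U (x, y)\<bar> \<le> 1" if "x \<in> space M" "y \<in> space M" for x y
  proof -
    have "W1 (x, y) \<in> {0..1}" "W2 (x, y) \<in> {0..1}"
      using assms(2,3) that by (auto simp: monotone_kernel_def kernel_on_def)
    then show ?thesis by (auto simp: U_def)
  qed
  have d01: "0 \<le> d" "d \<le> 1"
    using cut_norm_nonneg[OF U U_le] cut_norm_le_1[OF U U_le] by (auto simp: d_def)
  have main: "L \<le> 4 / n + 2 * sqrt n * d" if "0 < n" for n :: nat
    using L1_norm_le[OF assms(2,3) that] by (simp add: L_def d_def U_def)
  have "L \<le> 10 * d powr (2 / 3)"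
  proof (cases "d = 0")
    case True
    \<comment> \<open>No finite n is optimal here: the bound 4 / n holds for every n and tends to 0,
      in accordance with \<open>0 powr (2 / 3) = 0\<close>.\<close>
    have "(\<lambda>n. 4 / real (Suc n)) \<longlonglongrightarrow> 4 * 0"
      using tendsto_mult[OF tendsto_const LIMSEQ_inverse_real_of_nat, of 4]
      by (simp add: inverse_eq_divide)
    then have "L \<le> 4 * 0"
      by (rule LIMSEQ_le_const) (use main[of "Suc _"] True in auto)
    then show ?thesis by (simp add: True)
  next
    case False
    with d01 have "0 < d" by simp
    \<comment> \<open>The target order of magnitude, so that d = p^(3/2). With n about 1 / p both
      error terms are of order p.\<close>
    define p where "p = d powr (2 / 3)"
    have p: "0 < p" "p \<le> 1"
      using \<open>0 < d\<close> d01 by (auto simp: p_def powr_le1)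
    have d_eq: "d = p * sqrt p"
      using \<open>0 < d\<close> by (simp add: p_def powr_half_sqrt[symmetric] powr_powr powr_add[symmetric])
    define n where "n = nat \<lceil>1 / p\<rceil>"
    have "0 < 1 / p" "1 \<le> 1 / p" using p by auto
    then have n: "0 < n" "1 / p \<le> n" "n \<le> 2 / p"
      unfolding n_def by linarith+
    have "4 / n \<le> 4 * p"
      using n p by (simp add: field_simps)
    moreover have "sqrt n * d \<le> 2 * p"
    proof -
      \<comment> \<open>The product n p is at most 2; the cruder bound 4 keeps the square root
        rational.\<close>
      have "sqrt n * sqrt p \<le> 2"
        using n p real_sqrt_le_mono[of "n * p" 4]
        by (simp add: real_sqrt_mult[symmetric] field_simps)
      then have "p * (sqrt n * sqrt p) \<le> p * 2" using p by (intro mult_left_mono) auto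
      then show ?thesis by (simp add: d_eq mult_ac)
    qed
    \<comment> \<open>The oscillation contributes 4 p and the cut norm term 2 times 2 p, which
      leaves room below 10 p.\<close>
    ultimately have "L \<le> 8 * p" using main[OF n(1)] by linarith
    then show ?thesis using p by (simp add: p_def[symmetric])
  qed
  then show ?thesis by (simp add: L_def d_def U_def)
qed

end
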